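(* Let $(S;\wedge,\vee)$ be a skew lattice. The following two identities are equivalent for $S$ (i.e. $S$ satisfies one for all $x,y,z\in S$ if and only if it satisfies the other for all $x,y,z\in S$): $$x\wedge ((y\wedge x)\vee (z\wedge x)) = ((x\wedge y)\vee (x\wedge z))\wedge x,$$ $$x\vee ((y\vee x)\wedge (z\vee x)) = ((x\vee y)\wedge (x\vee z))\vee x.$$ Moreover, $S$ satisfies either (and hence both) of these identities if and only if $S$ is linearly distributive.
   Context: A skew lattice is a set $S$ with two associative, idempotent binary operations $\wedge,\vee$ satisfying $x\wedge (x\vee y) = x = (y\vee x)\wedge x$ and $x\vee (x\wedge y) = x = (y\wedge x)\vee x$. It is distributive if it satisfies both $x\wedge (y\vee z)\wedge x = (x\wedge y\wedge x)\vee (x\wedge z\wedge x)$ and $x\vee (y\wedge z)\vee x = (x\vee y\vee x)\wedge (x\vee z\vee x)$. The natural preorder on $S$ is given by $a\succeq b$ iff $a\vee b\vee a=a$ (equivalently $b\wedge a\wedge b=b$). A subalgebra $T$ is totally preordered if for all $a,b\in T$, $a\succeq b$ or $b\succeq a$. $S$ is linearly distributive if every subalgebra of $S$ that is totally preordered under $\succeq$ is distributive. *)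

theory Defs
  imports Main
begin

text \<open>The underlying set is an explicit carrier, so that a subalgebra is again a structure
  for the same operations on the same type. As usual for the universal-algebraic notion of
  subalgebra, nothing excludes the empty carrier.\<close>

locale skew_lattice =
  fixes S :: "'a set"
    and meet :: "'a \<Rightarrow> 'a \<Rightarrow> 'a"  (infixl "\<sqinter>" 70)
    and join :: "'a \<Rightarrow> 'a \<Rightarrow> 'a"  (infixl "\<squnion>" 65)
  assumes meet_closed: "\<lbrakk>x \<in> S; y \<in> S\<rbrakk> \<Longrightarrow> x \<sqinter> y \<in> S"
    and join_closed: "\<lbrakk>x \<in> S; y \<in> S\<rbrakk> \<Longrightarrow> x \<squnion> y \<in> S"
    and meet_assoc: "\<lbrakk>x \<in> S; y \<in> S; z \<in> S\<rbrakk> \<Longrightarrow> (x \<sqinter> y) \<sqinter> z = x \<sqinter> (y \<sqinter> z)"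
    and join_assoc: "\<lbrakk>x \<in> S; y \<in> S; z \<in> S\<rbrakk> \<Longrightarrow> (x \<squnion> y) \<squnion> z = x \<squnion> (y \<squnion> z)"
    and meet_idem: "x \<in> S \<Longrightarrow> x \<sqinter> x = x"
    and join_idem: "x \<in> S \<Longrightarrow> x \<squnion> x = x"
    and meet_join_absorb_left: "\<lbrakk>x \<in> S; y \<in> S\<rbrakk> \<Longrightarrow> x \<sqinter> (x \<squnion> y) = x"
    and meet_join_absorb_right: "\<lbrakk>x \<in> S; y \<in> S\<rbrakk> \<Longrightarrow> (y \<squnion> x) \<sqinter> x = x"
    and join_meet_absorb_left: "\<lbrakk>x \<in> S; y \<in> S\<rbrakk> \<Longrightarrow> x \<squnion> (x \<sqinter> y) = x"
    and join_meet_absorb_right: "\<lbrakk>x \<in> S; y \<in> S\<rbrakk> \<Longrightarrow> (y \<sqinter> x) \<squnion> x = x"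

locale distributive_skew_lattice = skew_lattice +
  assumes meet_distrib: "\<lbrakk>x \<in> S; y \<in> S; z \<in> S\<rbrakk> \<Longrightarrow>
      x \<sqinter> (y \<squnion> z) \<sqinter> x = (x \<sqinter> y \<sqinter> x) \<squnion> (x \<sqinter> z \<sqinter> x)"
    and join_distrib: "\<lbrakk>x \<in> S; y \<in> S; z \<in> S\<rbrakk> \<Longrightarrow>
      x \<squnion> (y \<sqinter> z) \<squnion> x = (x \<squnion> y \<squnion> x) \<sqinter> (x \<squnion> z \<squnion> x)"

definition natural_preorder :: "('a \<Rightarrow> 'a \<Rightarrow> 'a) \<Rightarrow> 'a \<Rightarrow> 'a \<Rightarrow> bool" where
  "natural_preorder join a b \<longleftrightarrow> join (join a b) a = a"

definition subalgebra ::
    "'a set \<Rightarrow> ('a \<Rightarrow> 'a \<Rightarrow> 'a) \<Rightarrow> ('a \<Rightarrow> 'a \<Rightarrow> 'a) \<Rightarrow> 'a set \<Rightarrow> bool" where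
  "subalgebra S meet join T \<longleftrightarrow>
     T \<subseteq> S \<and> (\<forall>a\<in>T. \<forall>b\<in>T. meet a b \<in> T \<and> join a b \<in> T)"

definition totally_preordered :: "('a \<Rightarrow> 'a \<Rightarrow> 'a) \<Rightarrow> 'a set \<Rightarrow> bool" where
  "totally_preordered join T \<longleftrightarrow>
     (\<forall>a\<in>T. \<forall>b\<in>T. natural_preorder join a b \<or> natural_preorder join b a)"

definition linearly_distributive ::
    "'a set \<Rightarrow> ('a \<Rightarrow> 'a \<Rightarrow> 'a) \<Rightarrow> ('a \<Rightarrow> 'a \<Rightarrow> 'a) \<Rightarrow> bool" where
  "linearly_distributive S meet join \<longleftrightarrow>
     (\<forall>T. subalgebra S meet join T \<and> totally_preordered join T
        \<longrightarrow> distributive_skew_lattice T meet join)"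

end

theory Submission
  imports Defs
begin

text \<open>
  Write \<open>a \<preceq> b\<close> for the natural preorder and \<open>a \<approx> b\<close> for the equivalence that it induces.
  In an expression such as \<open>s \<sqinter> x \<sqinter> t\<close> a middle factor \<open>x\<close> above both \<open>s\<close> and \<open>t\<close> can be
  deleted (\<open>meet_middle_absorb\<close>), and dually for joins; most of the computations rest on this.
  The axioms are invariant under exchanging the operations and under reversing the arguments of
  both, and so is linear distributivity. So it suffices to prove that the first identity
  is equivalent to linear distributivity; the second identity is the first one for the
  skew lattice with the operations exchanged.

  From the identity to linear distributivity: a totally preordered subalgebra inherits the
  identity, so let \<open>S\<close> itself be totally preordered. Only the position of the outer variable \<open>x\<close>
  matters. If \<open>y, z \<preceq> x\<close>, the identity upgrades to the one-sided laws
  \<open>(y \<squnion> z) \<sqinter> x = (y \<sqinter> x) \<squnion> (z \<sqinter> x)\<close> and \<open>x \<sqinter> (y \<squnion> z) = (x \<sqinter> y) \<squnion> (x \<sqinter> z)\<close>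
  (\<open>meet_join_right\<close>, \<open>meet_join_left\<close>), which compose to the distributive law for meets. For the
  distributive law for joins the nontrivial case is \<open>x \<preceq> z \<preceq> y\<close> or its mirror image, where
  one applies those laws with \<open>x \<squnion> y \<squnion> x\<close> in the role of the top element
  (\<open>join_distrib_descending\<close>).

  From linear distributivity to the identity: put \<open>A = y \<sqinter> x\<close>, \<open>B = z \<sqinter> x\<close>, \<open>p = x \<sqinter> A\<close>, \<open>q = x \<sqinter> B\<close>.
  It is enough to show \<open>x \<sqinter> (A \<squnion> B) = p \<squnion> q\<close>, since the mirror image treats the other side and both
  sides become \<open>(x \<sqinter> y \<sqinter> x) \<squnion> (x \<sqinter> z \<sqinter> x)\<close>. In general \<open>A\<close> and \<open>B\<close> are not comparable, but
  \<open>A \<preceq> A \<squnion> B \<preceq> x\<close>, and the three equivalence classes of such a chain form a totally preordered,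
  hence distributive, subalgebra (\<open>chain_distributive\<close>). Working in the chain through \<open>A\<close> and in the
  one through \<open>B\<close> separately, one can replace \<open>A\<close> by \<open>p\<close> in \<open>x \<sqinter> (A \<squnion> B \<squnion> A)\<close>
  (\<open>sandwich_replace\<close>). Doing this for \<open>A\<close> and for \<open>B\<close> gives
  \<open>x \<sqinter> (A \<squnion> B \<squnion> A) = p \<squnion> q \<squnion> p\<close> (\<open>sandwich_split\<close>). Since
  \<open>A \<squnion> B = (A \<squnion> B \<squnion> A) \<squnion> (B \<squnion> A \<squnion> B)\<close> is a join of equivalent elements, the result for \<open>A \<squnion> B\<close>
  follows.
\<close>

section \<open>The natural preorder of a skew lattice\<close>

context skew_lattice
begin

lemmas closed [simp] = meet_closed join_closed
lemmas laws [simp] = meet_idem join_idem meet_join_absorb_left meet_join_absorb_right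
  join_meet_absorb_left join_meet_absorb_right
lemmas assoc [simp] = meet_assoc join_assoc

lemma dual: "skew_lattice S (\<squnion>) (\<sqinter>)"
  by unfold_locales simp_all

lemma mirror: "skew_lattice S (\<lambda>a b. b \<sqinter> a) (\<lambda>a b. b \<squnion> a)"
  by unfold_locales simp_all

lemma meet_left_idem [simp]: "\<lbrakk>a \<in> S; b \<in> S\<rbrakk> \<Longrightarrow> a \<sqinter> (a \<sqinter> b) = a \<sqinter> b"
  by (metis meet_assoc meet_idem)

lemma join_left_idem [simp]: "\<lbrakk>a \<in> S; b \<in> S\<rbrakk> \<Longrightarrow> a \<squnion> (a \<squnion> b) = a \<squnion> b"
  by (metis join_assoc join_idem)

lemma meet_repeat [simp]: "\<lbrakk>a \<in> S; b \<in> S\<rbrakk> \<Longrightarrow> a \<sqinter> (b \<sqinter> (a \<sqinter> b)) = a \<sqinter> b"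
  by (metis meet_assoc meet_idem meet_closed)

lemma join_repeat [simp]: "\<lbrakk>a \<in> S; b \<in> S\<rbrakk> \<Longrightarrow> a \<squnion> (b \<squnion> (a \<squnion> b)) = a \<squnion> b"
  by (metis join_assoc join_idem join_closed)

lemma join_repeat_left [simp]:
  "\<lbrakk>a \<in> S; b \<in> S; c \<in> S\<rbrakk> \<Longrightarrow> a \<squnion> (b \<squnion> (a \<squnion> (b \<squnion> c))) = a \<squnion> (b \<squnion> c)"
  using join_left_idem[of "a \<squnion> b" c] by simp

lemma meet_eq_left_iff: "\<lbrakk>a \<in> S; b \<in> S\<rbrakk> \<Longrightarrow> a \<sqinter> b = a \<longleftrightarrow> a \<squnion> b = b"
  by (metis meet_join_absorb_left join_meet_absorb_right)

lemma meet_eq_right_iff: "\<lbrakk>a \<in> S; b \<in> S\<rbrakk> \<Longrightarrow> a \<sqinter> b = b \<longleftrightarrow> a \<squnion> b = a"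
  by (metis meet_join_absorb_right join_meet_absorb_left)

definition below :: "'a \<Rightarrow> 'a \<Rightarrow> bool"  (infix "\<preceq>" 50)
  where "a \<preceq> b \<longleftrightarrow> a \<sqinter> b \<sqinter> a = a"

text \<open>A tail \<open>w\<close> is harmless: \<open>b\<close> absorbs \<open>a\<close> as soon as it has a factorisation that starts with
  \<open>b \<squnion> a\<close>. Meeting \<open>b \<squnion> a\<close> with this factorisation gives \<open>(b \<squnion> a) \<sqinter> b = b \<squnion> a\<close>, and the other
  absorption law removes the meet.\<close>
lemma below_if_join_eq:
  assumes "a \<in> S" "b \<in> S" "w \<in> S" "b \<squnion> a \<squnion> w = b"
  shows "b \<squnion> a \<squnion> b = b"
proof -
  have "(b \<squnion> a) \<sqinter> b = b \<squnion> a"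
    using assms meet_join_absorb_left[of "b \<squnion> a" w] by simp
  then show ?thesis
    using assms join_meet_absorb_right[of b "b \<squnion> a"] by simp
qed

lemma join_eq_imp_meet_eq:
  assumes "a \<in> S" "b \<in> S" "b \<squnion> a \<squnion> b = b"
  shows "a \<sqinter> b \<sqinter> a = a"
proof -
  have "b \<squnion> (a \<squnion> b) = b"
    using assms by simp
  then have "b \<sqinter> (a \<squnion> b) = a \<squnion> b"
    using assms by (metis meet_eq_right_iff join_closed)
  then have "a \<sqinter> b \<sqinter> (a \<squnion> b) = a"
    using assms by simp
  then show ?thesis
    using assms skew_lattice.below_if_join_eq[OF dual, of b a "a \<squnion> b"] by simp
qed

lemma below_iff_join: "\<lbrakk>a \<in> S; b \<in> S\<rbrakk> \<Longrightarrow> a \<preceq> b \<longleftrightarrow> b \<squnion> a \<squnion> b = b"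
  unfolding below_def
  using join_eq_imp_meet_eq skew_lattice.join_eq_imp_meet_eq[OF dual] by blast

lemma below_iff_join': "\<lbrakk>a \<in> S; b \<in> S\<rbrakk> \<Longrightarrow> a \<preceq> b \<longleftrightarrow> b \<squnion> (a \<squnion> b) = b"
  by (simp add: below_iff_join)

lemma below_dual: "\<lbrakk>a \<in> S; b \<in> S\<rbrakk> \<Longrightarrow> skew_lattice.below (\<squnion>) a b \<longleftrightarrow> b \<preceq> a"
  by (simp add: skew_lattice.below_def[OF dual] below_iff_join)

lemma below_mirror:
  "\<lbrakk>a \<in> S; b \<in> S\<rbrakk> \<Longrightarrow> skew_lattice.below (\<lambda>a b. b \<sqinter> a) a b \<longleftrightarrow> a \<preceq> b"
  by (simp add: skew_lattice.below_def[OF mirror] below_def)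

lemma below_refl [simp]: "a \<in> S \<Longrightarrow> a \<preceq> a"
  by (simp add: below_def)

lemma meet_below [simp]:
  assumes "a \<in> S" "b \<in> S"
  shows "a \<sqinter> b \<preceq> a" "a \<sqinter> b \<preceq> b"
  using assms by (simp_all add: below_def)

lemma below_join [simp]:
  assumes "a \<in> S" "b \<in> S"
  shows "a \<preceq> a \<squnion> b" "b \<preceq> a \<squnion> b"
  using assms by (simp_all add: below_iff_join)

text \<open>With \<open>w\<close> arbitrary, this upgrades \<open>a \<preceq> b\<close> to an insertion rule at the end of any join that
  starts with \<open>b\<close>. Transitivity and the least upper bound property both follow by inserting an
  element in this way and then applying the defining equation of the preorder.\<close>
lemma join_absorbs_below:
  assumes "a \<in> S" "b \<in> S" "w \<in> S" "a \<preceq> b"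
  shows "(b \<squnion> w) \<squnion> a \<squnion> (b \<squnion> w) = b \<squnion> w"
proof -
  have "b \<squnion> (a \<squnion> b) = b"
    using assms by (simp add: below_iff_join)
  then have 1: "b \<squnion> (a \<squnion> (b \<squnion> w)) = b \<squnion> w"
    using assms by (metis join_assoc join_closed)
  have "b \<squnion> w = (b \<squnion> (a \<squnion> (b \<squnion> w))) \<squnion> (a \<squnion> (b \<squnion> w))"
    using assms 1 by (metis join_assoc join_closed join_idem)
  then show ?thesis
    using assms 1 by (metis join_assoc join_closed)
qed

lemma below_trans:
  assumes "a \<in> S" "b \<in> S" "c \<in> S" "a \<preceq> b" "b \<preceq> c"
  shows "a \<preceq> c"
proof -
  have "c = c \<squnion> (b \<squnion> c)"
    using assms by (simp add: below_iff_join)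
  also have "\<dots> = c \<squnion> ((b \<squnion> c) \<squnion> a \<squnion> (b \<squnion> c))"
    using assms join_absorbs_below[of a b c] by simp
  also have "\<dots> = (c \<squnion> (b \<squnion> c)) \<squnion> a \<squnion> (b \<squnion> c)"
    using assms by simp
  also have "\<dots> = c \<squnion> a \<squnion> (b \<squnion> c)"
    using assms by (simp only: below_iff_join')
  finally show ?thesis
    using assms below_if_join_eq[of a c "b \<squnion> c"] by (simp add: below_iff_join)
qed

lemma join_least:
  assumes "a \<in> S" "b \<in> S" "c \<in> S" "a \<preceq> c" "b \<preceq> c"
  shows "a \<squnion> b \<preceq> c"
proof -
  have "c = c \<squnion> a \<squnion> c"
    using assms by (simp add: below_iff_join)
  also have "\<dots> = ((c \<squnion> a) \<squnion> b \<squnion> (c \<squnion> a)) \<squnion> c"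
    using assms join_absorbs_below[of b c a] by simp
  also have "\<dots> = c \<squnion> (a \<squnion> b) \<squnion> (c \<squnion> a \<squnion> c)"
    using assms by simp
  also have "\<dots> = c \<squnion> (a \<squnion> b) \<squnion> c"
    using assms by (simp only: below_iff_join)
  finally show ?thesis
    using assms by (simp add: below_iff_join)
qed

lemma meet_greatest:
  assumes "a \<in> S" "b \<in> S" "c \<in> S" "c \<preceq> a" "c \<preceq> b"
  shows "c \<preceq> a \<sqinter> b"
  using assms skew_lattice.join_least[OF dual, of a b c] by (simp add: below_dual)

text \<open>By absorption \<open>s = s \<sqinter> (s \<squnion> x)\<close> and \<open>t = (x \<squnion> t) \<sqinter> t\<close>. The elements \<open>s \<squnion> x\<close>, \<open>x\<close> and \<open>x \<squnion> t\<close> are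
  equivalent, and in the meet of three equivalent elements the middle one can be deleted. The
  regularity law \<open>x \<sqinter> y \<sqinter> x \<sqinter> z \<sqinter> x = x \<sqinter> y \<sqinter> z \<sqinter> x\<close> is a special case.\<close>
lemma meet_middle_absorb:
  assumes "s \<in> S" "x \<in> S" "t \<in> S" "s \<preceq> x" "t \<preceq> x"
  shows "s \<sqinter> x \<sqinter> t = s \<sqinter> t"
proof -
  let ?a = "s \<squnion> x" and ?b = "x \<squnion> t"
  have ab: "?a \<sqinter> x = x" "x \<sqinter> ?b = x" "x \<sqinter> ?a = ?a" "?b \<sqinter> x = ?b"
    using assms meet_eq_right_iff[of x ?a] meet_eq_left_iff[of ?b x] by (simp_all add: below_iff_join)
  have r: "?a \<sqinter> x \<sqinter> ?b = ?a \<sqinter> ?b"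
  proof -
    have "?a \<sqinter> x \<sqinter> ?b = x"
      using ab by simp
    have "?a \<sqinter> ?b = (x \<sqinter> ?a) \<sqinter> (?b \<sqinter> x)"
      using ab by simp
    also have "\<dots> = x \<sqinter> (?a \<sqinter> ?b) \<sqinter> x"
      using assms by simp
    also have "\<dots> = x"
    proof -
      have "x \<preceq> ?a \<sqinter> ?b"
        using assms by (simp add: meet_greatest)
      then show ?thesis
        unfolding below_def .
    qed
    finally show ?thesis
      using ab by simp
  qed
  have "s \<sqinter> x \<sqinter> t = (s \<sqinter> ?a) \<sqinter> x \<sqinter> (?b \<sqinter> t)"
    using assms by simp
  also have "\<dots> = s \<sqinter> (?a \<sqinter> x \<sqinter> ?b) \<sqinter> t"
    using assms by (simp del: laws)
  also have "\<dots> = (s \<sqinter> ?a) \<sqinter> (?b \<sqinter> t)"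
    unfolding r using assms by (simp del: laws)
  finally show ?thesis
    using assms by simp
qed

lemma join_middle_absorb:
  assumes "s \<in> S" "x \<in> S" "t \<in> S" "x \<preceq> s" "x \<preceq> t"
  shows "s \<squnion> x \<squnion> t = s \<squnion> t"
  using assms skew_lattice.meet_middle_absorb[OF dual, of s x t] by (simp add: below_dual)

end

section \<open>The identity implies linear distributivity\<close>

text \<open>The operations are parameters, so that exchanging them gives the second identity and the
  symmetries of skew lattices can be applied.\<close>
definition splitting_identity :: "'a set \<Rightarrow> ('a \<Rightarrow> 'a \<Rightarrow> 'a) \<Rightarrow> ('a \<Rightarrow> 'a \<Rightarrow> 'a) \<Rightarrow> bool" where
  "splitting_identity S meet join \<longleftrightarrow> (\<forall>x\<in>S. \<forall>y\<in>S. \<forall>z\<in>S.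
     meet x (join (meet y x) (meet z x)) = meet (join (meet x y) (meet x z)) x)"

context skew_lattice
begin

lemma splitting_identity_mirror:
  "splitting_identity S (\<sqinter>) (\<squnion>) \<Longrightarrow> splitting_identity S (\<lambda>a b. b \<sqinter> a) (\<lambda>a b. b \<squnion> a)"
  unfolding splitting_identity_def by simp

text \<open>The claim reduces to the join equation \<open>c \<squnion> a \<squnion> (y \<squnion> z) = c \<squnion> a\<close> for the restrictions \<open>c = y \<sqinter> x\<close> and
  \<open>a = z \<sqinter> x\<close>. This holds because \<open>c\<close> absorbs \<open>y\<close> and \<open>a\<close> absorbs \<open>z\<close> from the right, and the element
  that does the absorbing can be inserted where it is required.\<close>
lemma join_meet_restricted:
  assumes xyz: "x \<in> S" "y \<in> S" "z \<in> S" and le: "y \<preceq> x" "z \<preceq> x"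
  shows "((y \<squnion> z) \<sqinter> x) \<sqinter> ((y \<sqinter> x) \<squnion> (z \<sqinter> x)) = (y \<sqinter> x) \<squnion> (z \<sqinter> x)"
proof -
  define c a m where "c = y \<sqinter> x" and "a = z \<sqinter> x" and "m = y \<squnion> z"
  have S: "c \<in> S" "a \<in> S" "m \<in> S"
    using xyz by (simp_all add: c_def a_def m_def)
  have cy: "c \<squnion> y = c" and az: "a \<squnion> z = a"
    using xyz le meet_eq_right_iff[of "y \<sqinter> x" y] meet_eq_right_iff[of "z \<sqinter> x" z]
    by (simp_all add: c_def a_def below_def)
  have c_le: "c \<preceq> y" "a \<preceq> z"
    using xyz by (simp_all add: c_def a_def)
  have a_le: "a \<preceq> c \<squnion> a \<squnion> c"
    using S below_trans[of a "c \<squnion> a" "c \<squnion> a \<squnion> c"] by (simp only: below_join closed)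
  have "c \<squnion> a \<squnion> m = (c \<squnion> a \<squnion> y) \<squnion> z"
    using xyz S by (simp add: m_def)
  \<comment> \<open>insert \<open>c\<close> in front of \<open>y\<close> here, and \<open>a\<close> in front of \<open>z\<close> in a later step\<close>
  also have "\<dots> = (c \<squnion> a \<squnion> c \<squnion> y) \<squnion> z"
    using xyz S c_le by (simp only: join_middle_absorb closed below_join)
  also have "\<dots> = c \<squnion> a \<squnion> (c \<squnion> y) \<squnion> z"
    using xyz S by simp
  also have "\<dots> = (c \<squnion> a \<squnion> c) \<squnion> z"
    by (simp add: cy)
  also have "\<dots> = (c \<squnion> a \<squnion> c) \<squnion> a \<squnion> z"
    using xyz S c_le a_le by (simp only: join_middle_absorb closed)
  also have "\<dots> = c \<squnion> a \<squnion> (c \<squnion> (a \<squnion> z))"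
    using xyz S by simp
  also have "\<dots> = c \<squnion> a"
    using S by (simp add: az)
  finally have um: "c \<squnion> a \<squnion> m = c \<squnion> a" .
  have "c \<preceq> m" "a \<preceq> m"
    using xyz S c_le below_trans[of c y m] below_trans[of a z m] by (simp_all add: m_def)
  then have u_le: "c \<squnion> a \<preceq> m"
    using S by (simp add: join_least)
  have "m \<squnion> (c \<squnion> a) = m"
    using S u_le um by (simp add: below_iff_join)
  then have mu: "m \<sqinter> (c \<squnion> a) = c \<squnion> a"
    using S meet_eq_right_iff[of m "c \<squnion> a"] by simp
  have "m \<preceq> x" "c \<squnion> a \<preceq> x"
    using xyz S le by (simp_all add: m_def c_def a_def join_least)
  then have "m \<sqinter> x \<sqinter> (c \<squnion> a) = c \<squnion> a"
    using xyz S mu by (simp only: meet_middle_absorb closed)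
  then show ?thesis
    by (simp add: c_def a_def m_def)
qed

text \<open>With \<open>e\<close> for the left and \<open>u\<close> for the right side, \<open>e \<sqinter> u = u\<close> holds in every skew lattice. The
  identity says that \<open>x \<sqinter> u\<close> agrees with its mirror image \<open>u' \<sqinter> x\<close>, while \<open>x \<sqinter> e = e' \<sqinter> x\<close> by
  associativity; so \<open>x \<sqinter> u\<close> is absorbed by \<open>x \<sqinter> e\<close> on both sides, and as the two are equivalent
  they coincide. Finally \<open>x \<sqinter> e = x \<sqinter> u\<close> and \<open>e \<sqinter> u = u\<close> force \<open>e = u\<close>.\<close>
lemma meet_join_right:
  assumes id: "splitting_identity S (\<sqinter>) (\<squnion>)"
    and xyz: "x \<in> S" "y \<in> S" "z \<in> S" and le: "y \<preceq> x" "z \<preceq> x"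
  shows "(y \<squnion> z) \<sqinter> x = (y \<sqinter> x) \<squnion> (z \<sqinter> x)"
proof -
  define m e e' u u' where "m = y \<squnion> z" and "e = (y \<squnion> z) \<sqinter> x" and "e' = x \<sqinter> (y \<squnion> z)"
    and "u = (y \<sqinter> x) \<squnion> (z \<sqinter> x)" and "u' = (x \<sqinter> y) \<squnion> (x \<sqinter> z)"
  have S: "m \<in> S" "e \<in> S" "e' \<in> S" "u \<in> S" "u' \<in> S"
    using xyz by (simp_all add: m_def e_def e'_def u_def u'_def)
  have v: "x \<sqinter> u = u' \<sqinter> x"
    using id xyz unfolding splitting_identity_def u_def u'_def by blast
  have ee': "x \<sqinter> e = e' \<sqinter> x"
    using xyz by (simp add: e_def e'_def)
  have eu: "e \<sqinter> u = u"
    unfolding e_def u_def using xyz le by (rule join_meet_restricted)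
  have ue: "u' \<sqinter> e' = u'"
    using skew_lattice.join_meet_restricted[OF mirror, of x z y] xyz le
    by (simp add: below_mirror e'_def u'_def)
  have le_x: "e \<preceq> x" "e' \<preceq> x" "u \<preceq> x" "u' \<preceq> x"
    using xyz by (simp_all add: e_def e'_def u_def u'_def join_least)
  have 1: "(x \<sqinter> e) \<sqinter> (x \<sqinter> u) = x \<sqinter> u"
  proof -
    have "(x \<sqinter> e) \<sqinter> (x \<sqinter> u) = x \<sqinter> (e \<sqinter> x \<sqinter> u)"
      using xyz S by simp
    then show ?thesis
      using xyz S le_x eu by (simp only: meet_middle_absorb)
  qed
  have 2: "(x \<sqinter> u) \<sqinter> (x \<sqinter> e) = x \<sqinter> u"
  proof -
    have "(x \<sqinter> u) \<sqinter> (x \<sqinter> e) = (u' \<sqinter> x \<sqinter> e') \<sqinter> x"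
      unfolding v ee' using xyz S by simp
    then show ?thesis
      using xyz S le_x ue v by (simp only: meet_middle_absorb)
  qed
  have "y \<preceq> y \<sqinter> x" "z \<preceq> z \<sqinter> x"
    using xyz le by (simp_all add: meet_greatest)
  then have "y \<preceq> u" "z \<preceq> u"
    using xyz S below_trans[of y "y \<sqinter> x" u] below_trans[of z "z \<sqinter> x" u] by (simp_all add: u_def)
  then have m_u: "m \<preceq> u"
    using xyz S by (simp add: m_def join_least)
  have "u \<preceq> x \<sqinter> u"
    using xyz S le_x by (simp add: meet_greatest)
  moreover have "x \<sqinter> e \<preceq> e" "e \<preceq> m"
    using xyz S by (simp_all add: e_def m_def)
  ultimately have "x \<sqinter> e \<preceq> x \<sqinter> u"
    using xyz S m_u by (metis below_trans meet_closed)
  then have "(x \<sqinter> e) \<sqinter> (x \<sqinter> u) \<sqinter> (x \<sqinter> e) = x \<sqinter> e"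
    by (simp only: below_def)
  then have xe: "x \<sqinter> e = x \<sqinter> u"
    by (simp only: 1 2)
  have "e = e \<sqinter> x \<sqinter> e"
    using le_x by (simp only: below_def)
  also have "\<dots> = e \<sqinter> x \<sqinter> u"
    using xyz S xe by simp
  also have "\<dots> = u"
    using xyz S le_x eu by (simp only: meet_middle_absorb)
  finally show ?thesis
    unfolding e_def u_def .
qed

lemma meet_join_left:
  assumes "splitting_identity S (\<sqinter>) (\<squnion>)"
    and "x \<in> S" "y \<in> S" "z \<in> S" "y \<preceq> x" "z \<preceq> x"
  shows "x \<sqinter> (y \<squnion> z) = (x \<sqinter> y) \<squnion> (x \<sqinter> z)"
  using skew_lattice.meet_join_right[OF mirror splitting_identity_mirror, of x z y] assms
  by (simp add: below_mirror)

text \<open>If \<open>x\<close> lies below \<open>y\<close> or \<open>z\<close> both sides collapse to \<open>x\<close>; otherwise the two one-sided laws apply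
  in turn.\<close>
lemma chain_meet_distrib:
  assumes id: "splitting_identity S (\<sqinter>) (\<squnion>)"
    and tot: "\<And>a b. \<lbrakk>a \<in> S; b \<in> S\<rbrakk> \<Longrightarrow> a \<preceq> b \<or> b \<preceq> a"
    and xyz: "x \<in> S" "y \<in> S" "z \<in> S"
  shows "x \<sqinter> (y \<squnion> z) \<sqinter> x = (x \<sqinter> y \<sqinter> x) \<squnion> (x \<sqinter> z \<sqinter> x)"
proof -
  consider "y \<preceq> x" "z \<preceq> x" | "x \<preceq> y" | "x \<preceq> z"
    using tot xyz by blast
  then show ?thesis
  proof cases
    case 1
    have "x \<sqinter> (y \<squnion> z) \<sqinter> x = (x \<sqinter> y \<squnion> x \<sqinter> z) \<sqinter> x"
      using meet_join_left[OF id xyz 1] by simp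
    also have "\<dots> = (x \<sqinter> y \<sqinter> x) \<squnion> (x \<sqinter> z \<sqinter> x)"
      using xyz id by (intro meet_join_right) simp_all
    finally show ?thesis .
  next
    case 2
    then have "x \<preceq> y \<squnion> z"
      using xyz below_trans[of x y "y \<squnion> z"] by simp
    then have "x \<sqinter> (y \<squnion> z) \<sqinter> x = x" "x \<sqinter> y \<sqinter> x = x"
      using 2 by (simp_all only: below_def)
    then show ?thesis
      using xyz by simp
  next
    case 3
    then have "x \<preceq> y \<squnion> z"
      using xyz below_trans[of x z "y \<squnion> z"] by simp
    then have "x \<sqinter> (y \<squnion> z) \<sqinter> x = x" "x \<sqinter> z \<sqinter> x = x"
      using 3 by (simp_all only: below_def)
    then show ?thesis
      using xyz join_meet_absorb_right[of x "x \<sqinter> y"] by simp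
  qed
qed

text \<open>The element \<open>Y = x \<squnion> y \<squnion> x\<close> lies above \<open>x\<close>, \<open>y\<close> and \<open>z\<close>, and the left side \<open>t\<close> satisfies
  \<open>t = Y \<sqinter> t\<close>. Meets with \<open>Y\<close> distribute over joins of elements below it, which turns both \<open>Y \<sqinter> t\<close>
  and the right side \<open>Y \<sqinter> (x \<squnion> z \<squnion> x)\<close> into \<open>x \<squnion> (Y \<sqinter> z) \<squnion> x\<close>.\<close>
lemma join_distrib_descending:
  assumes id: "splitting_identity S (\<sqinter>) (\<squnion>)"
    and xyz: "x \<in> S" "y \<in> S" "z \<in> S" and le: "x \<preceq> z" "z \<preceq> y"
  shows "x \<squnion> (y \<sqinter> z) \<squnion> x = (x \<squnion> y \<squnion> x) \<sqinter> (x \<squnion> z \<squnion> x)"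
proof -
  define Y t where "Y = x \<squnion> y \<squnion> x" and "t = x \<squnion> (y \<sqinter> z) \<squnion> x"
  have S: "Y \<in> S" "t \<in> S"
    using xyz by (simp_all add: Y_def t_def)
  have xy: "x \<preceq> y"
    using xyz le below_trans by blast
  have x_yz: "x \<preceq> y \<sqinter> z"
    using xyz le xy by (simp add: meet_greatest)
  have yY: "y \<preceq> Y"
    using xyz below_trans[of y "y \<squnion> x" Y] by (simp add: Y_def)
  have xY: "x \<preceq> Y"
    using xyz S xy yY below_trans by blast
  have Yx: "Y \<sqinter> x = x"
    using xyz meet_join_absorb_right[of x "x \<squnion> y"] by (simp add: Y_def)
  have Yy: "Y \<preceq> y"
    using xyz xy by (simp add: Y_def join_least)
  have zY: "z \<preceq> Y"
    using xyz S le yY below_trans by blast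
  have yzY: "y \<sqinter> z \<preceq> Y"
    using xyz S zY below_trans[of "y \<sqinter> z" z Y] by simp
  have dist: "Y \<sqinter> (x \<squnion> w \<squnion> x) = x \<squnion> (Y \<sqinter> w) \<squnion> x" if "w \<in> S" "w \<preceq> Y" for w
  proof -
    have "Y \<sqinter> (x \<squnion> w \<squnion> x) = Y \<sqinter> (x \<squnion> w) \<squnion> Y \<sqinter> x"
      using that xyz S xY id by (intro meet_join_left) (simp_all add: join_least)
    also have "Y \<sqinter> (x \<squnion> w) = Y \<sqinter> x \<squnion> Y \<sqinter> w"
      using that xyz S xY id by (intro meet_join_left) simp_all
    finally show ?thesis
      by (simp only: Yx)
  qed
  have "Y \<squnion> t = x \<squnion> (y \<squnion> x \<squnion> (y \<sqinter> z)) \<squnion> x"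
    using xyz by (simp add: Y_def t_def)
  also have "\<dots> = x \<squnion> (y \<squnion> (y \<sqinter> z)) \<squnion> x"
    using xyz xy x_yz by (simp only: join_middle_absorb closed)
  also have "\<dots> = Y"
    using xyz by (simp only: laws Y_def)
  finally have "t = Y \<sqinter> t"
    using S meet_eq_right_iff[of Y t] by simp
  also have "\<dots> = x \<squnion> (Y \<sqinter> (y \<sqinter> z)) \<squnion> x"
    unfolding t_def using xyz yzY by (intro dist) simp_all
  also have "Y \<sqinter> (y \<sqinter> z) = Y \<sqinter> z"
    using xyz S Yy le meet_middle_absorb[of Y y z] by simp
  also have "x \<squnion> (Y \<sqinter> z) \<squnion> x = Y \<sqinter> (x \<squnion> z \<squnion> x)"
    using dist[of z] xyz zY by simp
  finally show ?thesis
    unfolding t_def Y_def .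
qed

lemma chain_join_distrib:
  assumes id: "splitting_identity S (\<sqinter>) (\<squnion>)"
    and tot: "\<And>a b. \<lbrakk>a \<in> S; b \<in> S\<rbrakk> \<Longrightarrow> a \<preceq> b \<or> b \<preceq> a"
    and xyz: "x \<in> S" "y \<in> S" "z \<in> S"
  shows "x \<squnion> (y \<sqinter> z) \<squnion> x = (x \<squnion> y \<squnion> x) \<sqinter> (x \<squnion> z \<squnion> x)"
proof -
  consider "x \<preceq> z" "z \<preceq> y" | "x \<preceq> y" "y \<preceq> z" | "y \<preceq> x" | "z \<preceq> x"
    using tot xyz by blast
  then show ?thesis
  proof cases
    case 1
    then show ?thesis
      using join_distrib_descending[OF id xyz] by blast
  next
    case 2
    then show ?thesis
      using skew_lattice.join_distrib_descending[OF mirror splitting_identity_mirror, of x z y] id xyz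
      by (simp add: below_mirror)
  next
    case 3
    then have "y \<sqinter> z \<preceq> x"
      using xyz below_trans[of "y \<sqinter> z" y x] by simp
    then have "x \<squnion> (y \<sqinter> z) \<squnion> x = x" "x \<squnion> y \<squnion> x = x"
      using xyz 3 by (simp_all only: below_iff_join closed)
    then show ?thesis
      using xyz by simp
  next
    case 4
    then have "y \<sqinter> z \<preceq> x"
      using xyz below_trans[of "y \<sqinter> z" z x] by simp
    then have "x \<squnion> (y \<sqinter> z) \<squnion> x = x" "x \<squnion> z \<squnion> x = x"
      using xyz 4 by (simp_all only: below_iff_join closed)
    then show ?thesis
      using xyz meet_join_absorb_right[of x "x \<squnion> y"] by simp
  qed
qed

lemma skew_lattice_subalgebra:
  "subalgebra S (\<sqinter>) (\<squnion>) T \<Longrightarrow> skew_lattice T (\<sqinter>) (\<squnion>)"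
  unfolding subalgebra_def by unfold_locales (simp_all add: subset_iff)

lemma natural_preorder_iff: "\<lbrakk>a \<in> S; b \<in> S\<rbrakk> \<Longrightarrow> natural_preorder (\<squnion>) a b \<longleftrightarrow> b \<preceq> a"
  by (simp add: natural_preorder_def below_iff_join)

theorem splitting_identity_imp_linearly_distributive:
  assumes id: "splitting_identity S (\<sqinter>) (\<squnion>)"
  shows "linearly_distributive S (\<sqinter>) (\<squnion>)"
  unfolding linearly_distributive_def
proof (intro allI impI, elim conjE)
  fix T
  assume sub: "subalgebra S (\<sqinter>) (\<squnion>) T" and tot: "totally_preordered (\<squnion>) T"
  interpret T: skew_lattice T "(\<sqinter>)" "(\<squnion>)"
    using sub by (rule skew_lattice_subalgebra)
  have TS: "T \<subseteq> S"
    using sub by (simp add: subalgebra_def)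
  have idT: "splitting_identity T (\<sqinter>) (\<squnion>)"
    using id TS unfolding splitting_identity_def by blast
  have totT: "T.below a b \<or> T.below b a" if "a \<in> T" "b \<in> T" for a b
    using tot that by (auto simp: totally_preordered_def T.natural_preorder_iff)
  show "distributive_skew_lattice T (\<sqinter>) (\<squnion>)"
    by unfold_locales (rule T.chain_meet_distrib T.chain_join_distrib; use idT totT in blast)+
qed

section \<open>Symmetries of linear distributivity\<close>

lemma linearly_distributive_mirror:
  assumes ld: "linearly_distributive S (\<sqinter>) (\<squnion>)"
  shows "linearly_distributive S (\<lambda>a b. b \<sqinter> a) (\<lambda>a b. b \<squnion> a)"
  unfolding linearly_distributive_def
proof (intro allI impI, elim conjE)
  fix T
  assume "subalgebra S (\<lambda>a b. b \<sqinter> a) (\<lambda>a b. b \<squnion> a) T"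
    and tot: "totally_preordered (\<lambda>a b. b \<squnion> a) T"
  then have sub: "subalgebra S (\<sqinter>) (\<squnion>) T"
    by (simp add: subalgebra_def)
  interpret T: skew_lattice T "(\<sqinter>)" "(\<squnion>)"
    using sub by (rule skew_lattice_subalgebra)
  have "totally_preordered (\<squnion>) T"
    using tot by (simp add: totally_preordered_def natural_preorder_def)
  then interpret D: distributive_skew_lattice T "(\<sqinter>)" "(\<squnion>)"
    using ld sub by (simp add: linearly_distributive_def)
  show "distributive_skew_lattice T (\<lambda>a b. b \<sqinter> a) (\<lambda>a b. b \<squnion> a)"
  proof (intro distributive_skew_lattice.intro distributive_skew_lattice_axioms.intro T.mirror)
    fix x y z
    assume xyz: "x \<in> T" "y \<in> T" "z \<in> T"
    show "x \<sqinter> ((z \<squnion> y) \<sqinter> x) = (x \<sqinter> (z \<sqinter> x)) \<squnion> (x \<sqinter> (y \<sqinter> x))"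
      using xyz D.meet_distrib[of x z y] by simp
    show "x \<squnion> ((z \<sqinter> y) \<squnion> x) = (x \<squnion> (z \<squnion> x)) \<sqinter> (x \<squnion> (y \<squnion> x))"
      using xyz D.join_distrib[of x z y] by simp
  qed
qed

lemma linearly_distributive_dual:
  assumes ld: "linearly_distributive S (\<sqinter>) (\<squnion>)"
  shows "linearly_distributive S (\<squnion>) (\<sqinter>)"
  unfolding linearly_distributive_def
proof (intro allI impI, elim conjE)
  fix T
  assume "subalgebra S (\<squnion>) (\<sqinter>) T" and tot: "totally_preordered (\<sqinter>) T"
  then have sub: "subalgebra S (\<sqinter>) (\<squnion>) T"
    by (simp add: subalgebra_def)
  interpret T: skew_lattice T "(\<sqinter>)" "(\<squnion>)"
    using sub by (rule skew_lattice_subalgebra)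
  have "natural_preorder (\<sqinter>) a b \<longleftrightarrow> natural_preorder (\<squnion>) b a" if "a \<in> T" "b \<in> T" for a b
    using that T.below_iff_join[of a b] by (simp add: T.below_def natural_preorder_def)
  then have "totally_preordered (\<squnion>) T"
    using tot by (auto simp: totally_preordered_def)
  then interpret D: distributive_skew_lattice T "(\<sqinter>)" "(\<squnion>)"
    using ld sub by (simp add: linearly_distributive_def)
  show "distributive_skew_lattice T (\<squnion>) (\<sqinter>)"
    by (intro distributive_skew_lattice.intro distributive_skew_lattice_axioms.intro T.dual)
      (fact D.join_distrib D.meet_distrib)+
qed

section \<open>Linear distributivity implies the identity\<close>

definition equiv_below :: "'a \<Rightarrow> 'a \<Rightarrow> bool"  (infix "\<approx>" 50)
  where "a \<approx> b \<longleftrightarrow> a \<preceq> b \<and> b \<preceq> a"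

lemma meet_equiv: "\<lbrakk>a \<in> S; b \<in> S; a \<preceq> b\<rbrakk> \<Longrightarrow> a \<sqinter> b \<approx> a \<and> b \<sqinter> a \<approx> a"
  by (simp add: equiv_below_def meet_greatest)

lemma join_equiv: "\<lbrakk>a \<in> S; b \<in> S; a \<preceq> b\<rbrakk> \<Longrightarrow> a \<squnion> b \<approx> b \<and> b \<squnion> a \<approx> b"
  by (simp add: equiv_below_def join_least)

lemma equiv_trans: "\<lbrakk>a \<in> S; b \<in> S; c \<in> S; a \<approx> b; b \<approx> c\<rbrakk> \<Longrightarrow> a \<approx> c"
  using below_trans[of a b c] below_trans[of c b a] by (simp add: equiv_below_def)

text \<open>This is the only way in which linear distributivity is used below: it provides, for each chain
  of three elements, a distributive subalgebra that contains everything equivalent to one of them.\<close>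
lemma chain_distributive:
  assumes ld: "linearly_distributive S (\<sqinter>) (\<squnion>)"
    and S: "x \<in> S" "t \<in> S" "p \<in> S" and le: "p \<preceq> t" "t \<preceq> x"
  shows "distributive_skew_lattice {e \<in> S. e \<approx> x \<or> e \<approx> t \<or> e \<approx> p} (\<sqinter>) (\<squnion>)"
    (is "distributive_skew_lattice ?T _ _")
proof -
  have TS: "a \<in> S" if "a \<in> ?T" for a
    using that by simp
  have px: "p \<preceq> x"
    using S le below_trans[of p t x] by simp
  have tot: "a \<preceq> b \<or> b \<preceq> a" if "a \<in> ?T" "b \<in> ?T" for a b
  proof -
    have "\<exists>c\<in>{x, t, p}. a \<approx> c" "\<exists>d\<in>{x, t, p}. b \<approx> d"
      using that by simp_all
    then obtain c d where cd: "c \<in> {x, t, p}" "a \<approx> c" "d \<in> {x, t, p}" "b \<approx> d"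
      by (elim bexE)
    then have S': "a \<in> S" "b \<in> S" "c \<in> S" "d \<in> S"
      using that S by auto
    have "c \<preceq> d \<or> d \<preceq> c"
      using cd S le px by auto
    then show ?thesis
    proof
      assume "c \<preceq> d"
      then have "a \<preceq> d"
        using S' cd below_trans[of a c d] by (simp add: equiv_below_def)
      then show ?thesis
        using S' cd below_trans[of a d b] by (simp add: equiv_below_def)
    next
      assume "d \<preceq> c"
      then have "b \<preceq> c"
        using S' cd below_trans[of b d c] by (simp add: equiv_below_def)
      then show ?thesis
        using S' cd below_trans[of b c a] by (simp add: equiv_below_def)
    qed
  qed
  have equiv: "b \<in> ?T" if "b \<in> S" "b \<approx> a" "a \<in> ?T" for a b
    using that S equiv_trans[of b a x] equiv_trans[of b a t] equiv_trans[of b a p] by auto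
  have "a \<sqinter> b \<in> ?T \<and> a \<squnion> b \<in> ?T" if "a \<in> ?T" "b \<in> ?T" for a b
    using tot[OF that]
  proof
    assume "a \<preceq> b"
    then have "a \<sqinter> b \<approx> a" "a \<squnion> b \<approx> b"
      using that meet_equiv join_equiv by simp_all
    then show ?thesis
      using that TS equiv[of "a \<sqinter> b" a] equiv[of "a \<squnion> b" b] by (simp only: closed)
  next
    assume "b \<preceq> a"
    then have "a \<sqinter> b \<approx> b" "a \<squnion> b \<approx> a"
      using that meet_equiv join_equiv by simp_all
    then show ?thesis
      using that TS equiv[of "a \<sqinter> b" b] equiv[of "a \<squnion> b" a] by (simp only: closed)
  qed
  then have "subalgebra S (\<sqinter>) (\<squnion>) ?T"
    unfolding subalgebra_def by blast
  moreover have "totally_preordered (\<squnion>) ?T"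
    unfolding totally_preordered_def using tot by (auto simp: natural_preorder_iff)
  ultimately show ?thesis
    using ld unfolding linearly_distributive_def by blast
qed

text \<open>The elements \<open>A\<close> with \<open>A \<sqinter> x = A\<close> are those of the form \<open>y \<sqinter> x\<close>. They lie below \<open>x\<close>, and for them
  the factor \<open>x\<close> on the right can be dropped from the distributive law for meets.\<close>
lemma right_fixed_join:
  assumes "x \<in> S" "A \<in> S" "B \<in> S" "A \<sqinter> x = A" "B \<sqinter> x = B"
  shows "(A \<squnion> B) \<sqinter> x = A \<squnion> B"
  using assms by (simp add: meet_eq_left_iff)

lemma right_fixed_below: "\<lbrakk>x \<in> S; A \<in> S; A \<sqinter> x = A\<rbrakk> \<Longrightarrow> A \<preceq> x"
  by (simp add: below_def flip: meet_assoc)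

lemma meet_join_chain:
  assumes ld: "linearly_distributive S (\<sqinter>) (\<squnion>)"
    and S: "x \<in> S" "A \<in> S" "B \<in> S" and rf: "A \<sqinter> x = A" "B \<sqinter> x = B"
    and cmp: "A \<preceq> B \<or> B \<preceq> A"
  shows "x \<sqinter> (A \<squnion> B) = (x \<sqinter> A) \<squnion> (x \<sqinter> B)"
proof -
  obtain T where T: "distributive_skew_lattice T (\<sqinter>) (\<squnion>)" "x \<in> T" "A \<in> T" "B \<in> T"
    using cmp
  proof
    assume "A \<preceq> B"
    show ?thesis
      by (rule that[OF chain_distributive[OF ld, of x B A]])
        (use S rf \<open>A \<preceq> B\<close> in \<open>simp_all add: right_fixed_below equiv_below_def\<close>)
  next
    assume "B \<preceq> A"
    show ?thesis
      by (rule that[OF chain_distributive[OF ld, of x A B]])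
        (use S rf \<open>B \<preceq> A\<close> in \<open>simp_all add: right_fixed_below equiv_below_def\<close>)
  qed
  have "x \<sqinter> (A \<squnion> B) \<sqinter> x = (x \<sqinter> A \<sqinter> x) \<squnion> (x \<sqinter> B \<sqinter> x)"
    using T by (simp only: distributive_skew_lattice.meet_distrib)
  then show ?thesis
    using S rf right_fixed_join[OF S rf] by simp
qed

lemma join_meet_chain:
  assumes ld: "linearly_distributive S (\<sqinter>) (\<squnion>)"
    and S: "x \<in> S" "A \<in> S" "t \<in> S" and rf: "A \<sqinter> x = A" "t \<sqinter> x = t"
    and le: "A \<preceq> t"
  shows "(x \<sqinter> A) \<squnion> (x \<sqinter> t) \<squnion> (x \<sqinter> A) = x \<sqinter> ((x \<sqinter> A) \<squnion> t \<squnion> (x \<sqinter> A))"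
proof -
  let ?p = "x \<sqinter> A"
  have "x \<sqinter> A \<approx> A"
    using S rf by (simp add: meet_equiv right_fixed_below)
  then have T: "distributive_skew_lattice {e \<in> S. e \<approx> x \<or> e \<approx> t \<or> e \<approx> A} (\<sqinter>) (\<squnion>)"
    "x \<in> {e \<in> S. e \<approx> x \<or> e \<approx> t \<or> e \<approx> A}" "t \<in> {e \<in> S. e \<approx> x \<or> e \<approx> t \<or> e \<approx> A}"
    "?p \<in> {e \<in> S. e \<approx> x \<or> e \<approx> t \<or> e \<approx> A}"
    using chain_distributive[OF ld, of x t A] S rf le
    by (simp_all add: right_fixed_below equiv_below_def)
  have "?p \<squnion> x \<squnion> ?p = x"
    using S rf join_meet_absorb_right[of x "x \<sqinter> A"] by simp
  then show ?thesis
    using distributive_skew_lattice.join_distrib[OF T(1,4,2,3)] by simp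
qed

text \<open>All joins here are comparable with \<open>A\<close>, so the laws for chains apply: the left side is
  \<open>p \<squnion> x \<sqinter> (B \<squnion> A) \<squnion> p\<close> for \<open>p = x \<sqinter> A\<close>, and the distributive law for joins moves \<open>x\<close> to the front.
  The remaining \<open>A\<close> disappears because \<open>A \<squnion> p = p\<close>.\<close>
lemma sandwich_replace:
  assumes ld: "linearly_distributive S (\<sqinter>) (\<squnion>)"
    and S: "x \<in> S" "A \<in> S" "B \<in> S" and rf: "A \<sqinter> x = A" "B \<sqinter> x = B"
  shows "x \<sqinter> (A \<squnion> B \<squnion> A) = x \<sqinter> ((x \<sqinter> A) \<squnion> B \<squnion> (x \<sqinter> A))"
proof -
  let ?p = "x \<sqinter> A"
  have rf': "(B \<squnion> A) \<sqinter> x = B \<squnion> A"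
    using S rf by (simp add: right_fixed_join)
  have Ap: "A \<squnion> ?p = ?p"
    using S right_fixed_below[OF S(1,2) rf(1)] meet_eq_left_iff[of A ?p] by (simp add: below_def)
  have "x \<sqinter> (A \<squnion> B \<squnion> A) = ?p \<squnion> x \<sqinter> (B \<squnion> A)"
    using S rf rf' meet_join_chain[OF ld, of x A "B \<squnion> A"] by simp
  also have "\<dots> = ?p \<squnion> (x \<sqinter> (B \<squnion> A) \<squnion> ?p)"
    using S rf rf' meet_join_chain[OF ld, of x "B \<squnion> A" A] by simp
  also have "\<dots> = x \<sqinter> (?p \<squnion> (B \<squnion> A) \<squnion> ?p)"
    using S rf rf' join_meet_chain[OF ld, of x A "B \<squnion> A"] by simp
  also have "\<dots> = x \<sqinter> (?p \<squnion> B \<squnion> (A \<squnion> ?p))"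
    using S by simp
  finally show ?thesis
    by (simp only: Ap)
qed

lemma meet_join_decompose:
  assumes ld: "linearly_distributive S (\<sqinter>) (\<squnion>)"
    and S: "x \<in> S" "A \<in> S" "B \<in> S" and rf: "A \<sqinter> x = A" "B \<sqinter> x = B"
  shows "x \<sqinter> (A \<squnion> B) = x \<sqinter> (A \<squnion> B \<squnion> A) \<squnion> x \<sqinter> (B \<squnion> A \<squnion> B)"
proof -
  have le: "A \<squnion> B \<squnion> A \<preceq> B \<squnion> A \<squnion> B"
    using S by (simp add: below_iff_join)
  have "x \<sqinter> ((A \<squnion> B \<squnion> A) \<squnion> (B \<squnion> A \<squnion> B)) = x \<sqinter> (A \<squnion> B \<squnion> A) \<squnion> x \<sqinter> (B \<squnion> A \<squnion> B)"
    using S rf le by (intro meet_join_chain[OF ld]) (simp_all add: right_fixed_join)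
  moreover have "(A \<squnion> B \<squnion> A) \<squnion> (B \<squnion> A \<squnion> B) = A \<squnion> B"
    using S by simp
  ultimately show ?thesis
    by simp
qed

text \<open>With \<open>p = x \<sqinter> A\<close> and \<open>q = x \<sqinter> B\<close>, let \<open>G = x \<sqinter> (p \<squnion> B \<squnion> p)\<close>, which by \<open>sandwich_replace\<close> is the left side, and \<open>s = p \<squnion> q \<squnion> p\<close>. In
  \<open>x \<sqinter> (B \<squnion> p \<squnion> B)\<close> the element \<open>B\<close> can be replaced by \<open>q\<close>, and then the meet with \<open>x\<close> has no effect. By
  \<open>meet_join_chain\<close> and \<open>meet_join_decompose\<close> this expresses \<open>G\<close> as a join in which \<open>G\<close> occurs once, showing that \<open>G\<close>
  absorbs \<open>s\<close> on either side. Since also \<open>G \<preceq> s\<close>, the two are equal.\<close>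
lemma sandwich_split:
  assumes ld: "linearly_distributive S (\<sqinter>) (\<squnion>)"
    and S: "x \<in> S" "A \<in> S" "B \<in> S" and rf: "A \<sqinter> x = A" "B \<sqinter> x = B"
  shows "x \<sqinter> (A \<squnion> B \<squnion> A) = (x \<sqinter> A) \<squnion> (x \<sqinter> B) \<squnion> (x \<sqinter> A)"
proof -
  define p q where "p = x \<sqinter> A" and "q = x \<sqinter> B"
  have pq: "p \<in> S" "q \<in> S" "p \<sqinter> x = p" "q \<sqinter> x = q" "x \<sqinter> p = p" "x \<sqinter> q = q"
    using S rf by (simp_all add: p_def q_def)
  define G where "G = x \<sqinter> (p \<squnion> B \<squnion> p)"
  define s where "s = p \<squnion> q \<squnion> p"
  have GS: "G \<in> S" "s \<in> S"
    using S pq by (simp_all add: G_def s_def)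
  have xq: "x \<sqinter> (q \<squnion> p \<squnion> q) = q \<squnion> p \<squnion> q"
  proof -
    have "x \<squnion> (q \<squnion> p \<squnion> q) = x"
      using S pq meet_eq_right_iff[of x p] meet_eq_right_iff[of x q] by (simp flip: join_assoc)
    then show ?thesis
      using S pq meet_eq_right_iff[of x "q \<squnion> p \<squnion> q"] by simp
  qed
  have K: "x \<sqinter> (B \<squnion> p \<squnion> B) = q \<squnion> p \<squnion> q"
    using sandwich_replace[OF ld, of x B p] S rf pq xq by (simp add: q_def)
  have G1: "G = p \<squnion> q \<squnion> G"
  proof -
    have "G = x \<sqinter> (p \<squnion> (B \<squnion> p))"
      using S pq by (simp add: G_def)
    also have "\<dots> = x \<sqinter> p \<squnion> x \<sqinter> (B \<squnion> p)"
      using S pq rf by (intro meet_join_chain[OF ld]) (simp_all add: right_fixed_join)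
    also have "x \<sqinter> (B \<squnion> p) = (q \<squnion> p \<squnion> q) \<squnion> G"
      using meet_join_decompose[OF ld, of x B p] S pq rf K by (simp add: G_def)
    finally show ?thesis
      using pq GS by simp
  qed
  have G2: "G = G \<squnion> q \<squnion> p"
  proof -
    have "G = x \<sqinter> ((p \<squnion> B) \<squnion> p)"
      by (simp add: G_def)
    also have "\<dots> = x \<sqinter> (p \<squnion> B) \<squnion> x \<sqinter> p"
      using S pq rf by (intro meet_join_chain[OF ld]) (simp_all add: right_fixed_join)
    also have "x \<sqinter> (p \<squnion> B) = G \<squnion> (q \<squnion> p \<squnion> q)"
      using meet_join_decompose[OF ld, of x p B] S pq rf K by (simp add: G_def)
    finally show ?thesis
      using pq GS by simp
  qed
  have "p \<squnion> G = G"
    using G1 pq GS by (metis join_assoc join_closed join_idem)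
  then have sG: "s \<squnion> G = G"
    using G1 pq GS by (simp add: s_def)
  have "G \<squnion> p = G"
    using G2 pq GS by (metis join_assoc join_closed join_idem)
  then have Gs: "G \<squnion> s = G"
    using G2 pq GS unfolding s_def by (metis join_assoc join_closed)
  have "B \<preceq> q"
    using S rf right_fixed_below[of x B] by (simp add: q_def meet_greatest)
  moreover have "q \<preceq> s"
    using pq below_trans[of q "q \<squnion> p" s] by (simp add: s_def)
  ultimately have "B \<preceq> s"
    using S pq GS below_trans by blast
  then have "p \<squnion> B \<squnion> p \<preceq> s"
    using S pq by (simp add: s_def join_least)
  then have "G \<preceq> s"
    using S pq GS below_trans[of G "p \<squnion> B \<squnion> p" s] by (simp add: G_def)
  then have "s \<squnion> G \<squnion> s = s"
    using GS by (simp only: below_iff_join)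
  then have "G = s"
    by (simp only: sG Gs)
  then show ?thesis
    using sandwich_replace[OF ld S rf] by (simp add: G_def s_def p_def q_def)
qed

lemma meet_join_split:
  assumes ld: "linearly_distributive S (\<sqinter>) (\<squnion>)"
    and S: "x \<in> S" "A \<in> S" "B \<in> S" and rf: "A \<sqinter> x = A" "B \<sqinter> x = B"
  shows "x \<sqinter> (A \<squnion> B) = (x \<sqinter> A) \<squnion> (x \<sqinter> B)"
  using meet_join_decompose[OF ld S rf] sandwich_split[OF ld S rf]
    sandwich_split[OF ld, of x B A] S rf by simp

theorem linearly_distributive_imp_splitting_identity:
  assumes ld: "linearly_distributive S (\<sqinter>) (\<squnion>)"
  shows "splitting_identity S (\<sqinter>) (\<squnion>)"
  unfolding splitting_identity_def
proof (intro ballI)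
  fix x y z
  assume S: "x \<in> S" "y \<in> S" "z \<in> S"
  have "x \<sqinter> ((y \<sqinter> x) \<squnion> (z \<sqinter> x)) = (x \<sqinter> (y \<sqinter> x)) \<squnion> (x \<sqinter> (z \<sqinter> x))"
    using S by (intro meet_join_split[OF ld]) simp_all
  moreover have "((x \<sqinter> y) \<squnion> (x \<sqinter> z)) \<sqinter> x = (x \<sqinter> y \<sqinter> x) \<squnion> (x \<sqinter> z \<sqinter> x)"
    using S skew_lattice.meet_join_split[OF mirror linearly_distributive_mirror[OF ld],
        of x "x \<sqinter> z" "x \<sqinter> y"] by simp
  ultimately show "x \<sqinter> ((y \<sqinter> x) \<squnion> (z \<sqinter> x)) = ((x \<sqinter> y) \<squnion> (x \<sqinter> z)) \<sqinter> x"
    using S by simp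
qed

theorem splitting_identity_iff_linearly_distributive:
  "splitting_identity S (\<sqinter>) (\<squnion>) \<longleftrightarrow> linearly_distributive S (\<sqinter>) (\<squnion>)"
  using splitting_identity_imp_linearly_distributive
    linearly_distributive_imp_splitting_identity by blast

theorem dual_splitting_identity_iff_linearly_distributive:
  "splitting_identity S (\<squnion>) (\<sqinter>) \<longleftrightarrow> linearly_distributive S (\<sqinter>) (\<squnion>)"
  using skew_lattice.splitting_identity_iff_linearly_distributive[OF dual]
    linearly_distributive_dual skew_lattice.linearly_distributive_dual[OF dual] by blast

end

theorem theorem3p6:
  fixes S :: "'a set"
    and meet :: "'a \<Rightarrow> 'a \<Rightarrow> 'a"  (infixl "\<sqinter>" 70)
    and join :: "'a \<Rightarrow> 'a \<Rightarrow> 'a"  (infixl "\<squnion>" 65)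
  assumes "skew_lattice S (\<sqinter>) (\<squnion>)"
  shows "((\<forall>x\<in>S. \<forall>y\<in>S. \<forall>z\<in>S.
              x \<sqinter> ((y \<sqinter> x) \<squnion> (z \<sqinter> x)) = ((x \<sqinter> y) \<squnion> (x \<sqinter> z)) \<sqinter> x)
          \<longleftrightarrow> (\<forall>x\<in>S. \<forall>y\<in>S. \<forall>z\<in>S.
              x \<squnion> ((y \<squnion> x) \<sqinter> (z \<squnion> x)) = ((x \<squnion> y) \<sqinter> (x \<squnion> z)) \<squnion> x))
       \<and> ((\<forall>x\<in>S. \<forall>y\<in>S. \<forall>z\<in>S.
              x \<sqinter> ((y \<sqinter> x) \<squnion> (z \<sqinter> x)) = ((x \<sqinter> y) \<squnion> (x \<sqinter> z)) \<sqinter> x)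
          \<longleftrightarrow> linearly_distributive S (\<sqinter>) (\<squnion>))
       \<and> ((\<forall>x\<in>S. \<forall>y\<in>S. \<forall>z\<in>S.
              x \<squnion> ((y \<squnion> x) \<sqinter> (z \<squnion> x)) = ((x \<squnion> y) \<sqinter> (x \<squnion> z)) \<squnion> x)
          \<longleftrightarrow> linearly_distributive S (\<sqinter>) (\<squnion>))"
  using skew_lattice.splitting_identity_iff_linearly_distributive[OF assms]
    skew_lattice.dual_splitting_identity_iff_linearly_distributive[OF assms]
  unfolding splitting_identity_def by blast

end
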